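(* For any graph $G$ with at least one edge, with chromatic index $c$ and fractional chromatic index $c_f$, \[\left\lfloor\tfrac{1}{2c}|E(G)|\right\rfloor-1 \leq \mathrm{cms}(G) \leq \tfrac{1}{c_f}|E(G)|.\] Furthermore, for any integers $\Delta \geq 2$ and $n \geq \Delta+1$, there is a graph $G$ of order $n$ such that $\mathrm{cms}(G) \leq \frac{1}{\Delta+1}|E(G)|$.
   Context: All graphs are finite and simple. For a graph $G$ with $m$ edges, an ordering of $G$ is a bijection $\ell: E(G)\to\mathbb{Z}_m$. For distinct edges $e,e'$, $d_\ell(e,e')$ is the smallest positive integer $d$ with $\ell(e)+d=\ell(e')$ in $\mathbb{Z}_m$, and $d_\ell\{e,e'\}=\min\{d_\ell(e,e'),d_\ell(e',e)\}$. Two edges are adjacent if they share a vertex. $\mathrm{cms}(\ell)$ is the largest $s\in\{1,\dots,m\}$ such that $d_\ell\{e,e'\}\geq s$ for every pair of adjacent edges; $\mathrm{cms}(G)$ is the maximum of $\mathrm{cms}(\ell)$ over all orderings of $G$. The chromatic index is the minimum number of colours in a proper edge colouring. Let $\mathcal{M}(G)$ be the set of matchings of $G$ and $\mathcal{M}_e(G)$ those containing edge $e$; a fractional edge colouring is a function $\omega:\mathcal{M}(G)\to\mathbb{R}_{\geq 0}$ with $\sum_{M\in\mathcal{M}_e(G)}\omega(M)\geq 1$ for each edge $e$, its weight is $\sum_{M}\omega(M)$, and the fractional chromatic index $c_f$ is the infimum of the weights of fractional edge colourings. *)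

theory Defs
  imports Complex_Main "HOL-Number_Theory.Cong"
begin

text \<open>A graph is given by its vertex set and its set of edges, each edge being a two-element set
  of vertices. All notions below depend on the edges only.\<close>

definition simple_graph :: "'a set \<Rightarrow> 'a set set \<Rightarrow> bool" where
  "simple_graph V E \<longleftrightarrow> finite V \<and> (\<forall>e\<in>E. e \<subseteq> V \<and> card e = 2)"

definition adjacent :: "'a set \<Rightarrow> 'a set \<Rightarrow> bool" where
  "adjacent e e' \<longleftrightarrow> e \<noteq> e' \<and> e \<inter> e' \<noteq> {}"

text \<open>The group \<open>\<int>\<^sub>m\<close>, with \<open>m = card E\<close>, is represented by the residues \<open>{..<m}\<close>.
  Values of an ordering outside \<open>E\<close> are irrelevant.\<close>

definition edge_ordering :: "'a set set \<Rightarrow> ('a set \<Rightarrow> nat) \<Rightarrow> bool" where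
  "edge_ordering E l \<longleftrightarrow> bij_betw l E {..<card E}"

definition cyc_dist :: "'a set set \<Rightarrow> ('a set \<Rightarrow> nat) \<Rightarrow> 'a set \<Rightarrow> 'a set \<Rightarrow> nat" where
  "cyc_dist E l e e' = (LEAST d. 0 < d \<and> [l e + d = l e'] (mod card E))"

definition cyc_dist_sym :: "'a set set \<Rightarrow> ('a set \<Rightarrow> nat) \<Rightarrow> 'a set \<Rightarrow> 'a set \<Rightarrow> nat" where
  "cyc_dist_sym E l e e' = min (cyc_dist E l e e') (cyc_dist E l e' e)"

definition cms_ordering :: "'a set set \<Rightarrow> ('a set \<Rightarrow> nat) \<Rightarrow> nat" where
  "cms_ordering E l = Max {s \<in> {1..card E}.
     \<forall>e\<in>E. \<forall>e'\<in>E. adjacent e e' \<longrightarrow> s \<le> cyc_dist_sym E l e e'}"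

text \<open>Like \<open>cms_ordering\<close>, this is meaningful only if \<open>E\<close> is finite and nonempty: for
  \<open>E = {}\<close> it involves the unspecified value \<open>Max {}\<close>.\<close>

definition cms :: "'a set set \<Rightarrow> nat" where
  "cms E = Max {cms_ordering E l | l. edge_ordering E l}"

definition proper_edge_colouring :: "'a set set \<Rightarrow> ('a set \<Rightarrow> nat) \<Rightarrow> bool" where
  "proper_edge_colouring E f \<longleftrightarrow> (\<forall>e\<in>E. \<forall>e'\<in>E. adjacent e e' \<longrightarrow> f e \<noteq> f e')"

definition chromatic_index :: "'a set set \<Rightarrow> nat" where
  "chromatic_index E = (LEAST k. \<exists>f. proper_edge_colouring E f \<and> card (f ` E) = k)"

definition matchings :: "'a set set \<Rightarrow> 'a set set set" where
  "matchings E = {M. M \<subseteq> E \<and> (\<forall>e\<in>M. \<forall>e'\<in>M. \<not> adjacent e e')}"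

definition fractional_edge_colouring :: "'a set set \<Rightarrow> ('a set set \<Rightarrow> real) \<Rightarrow> bool" where
  "fractional_edge_colouring E w \<longleftrightarrow>
     (\<forall>M\<in>matchings E. 0 \<le> w M) \<and> (\<forall>e\<in>E. 1 \<le> (\<Sum>M\<in>{M\<in>matchings E. e \<in> M}. w M))"

definition fractional_chromatic_index :: "'a set set \<Rightarrow> real" where
  "fractional_chromatic_index E =
     Inf {\<Sum>M\<in>matchings E. w M | w. fractional_edge_colouring E w}"

end

theory Submission
  imports Defs
begin

text \<open>For the lower bound, let \<open>h = \<lfloor>m / 2c\<rfloor>\<close>. Swapping colours on closed parts of two colour
  classes yields a proper colouring with \<open>c\<close> classes of at least \<open>2h\<close> edges each. Place the classes
  one after another around the cycle. Only the last \<open>h\<close> edges of a class and the first \<open>h\<close> edges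
  of the next one can be closer than \<open>h\<close>. Adjacency between these two blocks has maximum degree
  two, and then both blocks can be enumerated such that an edge at position \<open>a\<close> of the second block
  is only adjacent to edges at positions up to \<open>a + 1\<close> of the first; so distances are at least
  \<open>h - 1\<close>.

  For the upper bound, the \<open>m\<close> cyclic windows of \<open>s = cms G\<close> consecutive edges of an optimal ordering
  are matchings, and giving each of them weight \<open>1/s\<close> covers every edge exactly once.

  For the last claim, a star on \<open>n\<close> vertices with one additional edge has \<open>n\<close> edges; the two edges
  that follow the additional one in any ordering are adjacent.\<close>

section \<open>Bipartite relations of degree at most two\<close>

lemma sum_card_rel_swap:
  assumes "finite A" "finite B"
  shows "(\<Sum>y\<in>A. card {x \<in> B. R x y}) = (\<Sum>x\<in>B. card {y \<in> A. R x y})"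
proof -
  have "(\<Sum>y\<in>A. card {x \<in> B. R x y}) = (\<Sum>y\<in>A. \<Sum>x\<in>B. if R x y then 1 else 0)"
    using assms by (simp add: sum.If_cases Int_def)
  also have "\<dots> = (\<Sum>x\<in>B. \<Sum>y\<in>A. if R x y then 1 else 0)"
    by (rule sum.swap)
  also have "\<dots> = (\<Sum>x\<in>B. card {y \<in> A. R x y})"
    using assms by (simp add: sum.If_cases Int_def)
  finally show ?thesis .
qed

text \<open>Greedy construction: the next \<open>y\<close> is one with few neighbours outside
  \<open>xs\<close>, and these neighbours are appended to \<open>xs\<close>. The invariant
  \<open>length xs \<le> Suc j\<close> leaves room for them among the first \<open>j + 2\<close>
  entries, and later appends do not disturb earlier prefixes.\<close>

lemma paired_lists:
  fixes R :: "'b \<Rightarrow> 'c \<Rightarrow> bool"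
  assumes fin: "finite A" "finite B" and eq: "card A = card B"
    and degA: "\<And>y. y \<in> A \<Longrightarrow> card {x \<in> B. R x y} \<le> 2"
    and degB: "\<And>x. x \<in> B \<Longrightarrow> card {y \<in> A. R x y} \<le> 2"
  shows "j \<le> card A \<Longrightarrow> \<exists>ys xs. distinct ys \<and> distinct xs \<and> set ys \<subseteq> A \<and> set xs \<subseteq> B \<and>
    length ys = j \<and> length xs \<le> Suc j \<and>
    (\<forall>i<j. \<forall>x\<in>B. R x (ys ! i) \<longrightarrow> x \<in> set (take (i + 2) xs))"
proof (induction j)
  case 0
  show ?case by (intro exI[of _ "[]"]) auto
next
  case (Suc j)
  then obtain ys xs where d: "distinct ys" "distinct xs" "set ys \<subseteq> A" "set xs \<subseteq> B"
    "length ys = j" "length xs \<le> Suc j"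
    and nb: "\<And>i x. i < j \<Longrightarrow> x \<in> B \<Longrightarrow> R x (ys ! i) \<Longrightarrow> x \<in> set (take (i + 2) xs)"
    by (meson Suc_leD)
  have cys: "card (A - set ys) = card A - j"
    using d fin by (simp add: card_Diff_subset distinct_card)
  have cxs: "card (B - set xs) = card A - length xs"
    using d fin eq by (simp add: card_Diff_subset distinct_card)
  have lx: "length xs \<le> card A"
    using d fin eq by (metis card_mono distinct_card)
  \<comment> \<open>Otherwise \<open>length xs = j + 1\<close> and every unused \<open>y\<close> has two unused neighbours; but there are
    fewer unused \<open>x\<close> than \<open>y\<close>, and each of them has at most two neighbours.\<close>
  have "\<exists>y\<in>A - set ys. card {x \<in> B - set xs. R x y} + length xs \<le> j + 2"
  proof (rule ccontr)
    assume "\<not> ?thesis"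
    then have big: "\<And>y. y \<in> A - set ys \<Longrightarrow> j + 2 < card {x \<in> B - set xs. R x y} + length xs"
      by (meson not_le_imp_less)
    have le2: "card {x \<in> B - set xs. R x y} \<le> 2" if "y \<in> A - set ys" for y
    proof -
      have "card {x \<in> B - set xs. R x y} \<le> card {x \<in> B. R x y}"
        using fin by (intro card_mono) auto
      with degA[of y] that show ?thesis by auto
    qed
    obtain y0 where y0: "y0 \<in> A - set ys"
      using cys Suc.prems fin
      by (metis card.empty diff_is_0_eq ex_in_conv not_less_eq_eq order_refl)
    from big[OF y0] le2[OF y0] d(6) have lxj: "length xs = Suc j" by linarith
    have "(\<Sum>y\<in>A - set ys. 2) \<le> (\<Sum>y\<in>A - set ys. card {x \<in> B - set xs. R x y})"
      using big lxj by (intro sum_mono) fastforce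
    also have "\<dots> = (\<Sum>x\<in>B - set xs. card {y \<in> A - set ys. R x y})"
      using fin by (intro sum_card_rel_swap) auto
    also have "\<dots> \<le> (\<Sum>x\<in>B - set xs. 2)"
    proof (rule sum_mono)
      fix x assume x: "x \<in> B - set xs"
      have "card {y \<in> A - set ys. R x y} \<le> card {y \<in> A. R x y}"
        using fin by (intro card_mono) auto
      with degB[of x] x show "card {y \<in> A - set ys. R x y} \<le> 2" by auto
    qed
    finally have "card A - j \<le> card A - length xs"
      using cys cxs by simp
    with lxj lx Suc.prems show False by linarith
  qed
  then obtain y where y: "y \<in> A" "y \<notin> set ys"
    and cy: "card {x \<in> B - set xs. R x y} + length xs \<le> j + 2" by auto
  obtain zs where zs: "set zs = {x \<in> B - set xs. R x y}" "distinct zs"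
    using finite_distinct_list[of "{x \<in> B - set xs. R x y}"] fin by auto
  have lz: "length (xs @ zs) \<le> j + 2"
    using cy zs distinct_card by fastforce
  show ?case
  proof (intro exI conjI allI impI ballI)
    show "distinct (ys @ [y])" "set (ys @ [y]) \<subseteq> A" "length (ys @ [y]) = Suc j"
      using d y by auto
    show "distinct (xs @ zs)" "set (xs @ zs) \<subseteq> B"
      using d zs by auto
    show "length (xs @ zs) \<le> Suc (Suc j)" using lz by simp
    fix i x assume i: "i < Suc j" and x: "x \<in> B" and R: "R x ((ys @ [y]) ! i)"
    show "x \<in> set (take (i + 2) (xs @ zs))"
    proof (cases "i = j")
      case True
      then have "x \<in> set (xs @ zs)" using R x zs d(5) by (auto simp: nth_append)
      then show ?thesis using True lz by (metis take_all)
    next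
      case False
      then have "x \<in> set (take (i + 2) xs)"
        using R x i d(5) by (intro nb) (auto simp: nth_append)
      then show ?thesis by simp
    qed
  qed
qed

text \<open>For \<open>j = h\<close> the list \<open>ys\<close> exhausts \<open>A\<close>. Elements
  of \<open>B\<close> missing from \<open>xs\<close> are related to nothing in \<open>A\<close>, so
  they can be appended in any order. The enumerations are the positions in the two lists; lying in a
  prefix of length \<open>\<alpha> y + 2\<close> means having index at most
  \<open>\<alpha> y + 1\<close>.\<close>

lemma paired_enumerations:
  fixes R :: "'b \<Rightarrow> 'c \<Rightarrow> bool"
  assumes fin: "finite A" "finite B" and cA: "card A = h" and cB: "card B = h"
    and degA: "\<And>y. y \<in> A \<Longrightarrow> card {x \<in> B. R x y} \<le> 2"
    and degB: "\<And>x. x \<in> B \<Longrightarrow> card {y \<in> A. R x y} \<le> 2"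
  obtains \<beta> \<alpha> :: "_ \<Rightarrow> nat"
  where "bij_betw \<beta> B {..<h}" "bij_betw \<alpha> A {..<h}"
    "\<And>x y. x \<in> B \<Longrightarrow> y \<in> A \<Longrightarrow> R x y \<Longrightarrow> \<beta> x \<le> \<alpha> y + 1"
proof -
  obtain ys xs where d: "distinct ys" "distinct xs" "set ys \<subseteq> A" "set xs \<subseteq> B" "length ys = h"
    and nb: "\<And>i x. i < h \<Longrightarrow> x \<in> B \<Longrightarrow> R x (ys ! i) \<Longrightarrow> x \<in> set (take (i + 2) xs)"
  proof -
    have "\<exists>ys xs. distinct ys \<and> distinct xs \<and> set ys \<subseteq> A \<and> set xs \<subseteq> B \<and>
      length ys = h \<and> length xs \<le> Suc h \<and>
      (\<forall>i<h. \<forall>x\<in>B. R x (ys ! i) \<longrightarrow> x \<in> set (take (i + 2) xs))"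
      using assms by (intro paired_lists) auto
    then show ?thesis using that by blast
  qed
  have ys: "set ys = A"
    using d fin cA by (intro card_subset_eq) (auto simp: distinct_card)
  obtain zs where zs: "set zs = B - set xs" "distinct zs"
    using finite_distinct_list[of "B - set xs"] fin by auto
  let ?xs = "xs @ zs"
  have xs: "set ?xs = B" "distinct ?xs" using zs d by auto
  then have lx: "length ?xs = h" using cB by (metis distinct_card)
  let ?\<alpha> = "the_inv_into {..<h} ((!) ys)" and ?\<beta> = "the_inv_into {..<h} ((!) ?xs)"
  have bA: "bij_betw ((!) ys) {..<h} A" using d ys by (intro bij_betw_nth) auto
  have bB: "bij_betw ((!) ?xs) {..<h} B" using xs lx by (intro bij_betw_nth) auto
  show ?thesis
  proof (rule that)
    show "bij_betw ?\<beta> B {..<h}" "bij_betw ?\<alpha> A {..<h}"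
      using bB bA by (auto intro: bij_betw_the_inv_into)
    fix x y assume x: "x \<in> B" and y: "y \<in> A" and R: "R x y"
    have ay: "?\<alpha> y < h" "ys ! ?\<alpha> y = y"
      using bA y by (auto simp: bij_betw_def f_the_inv_into_f dest: the_inv_into_into[of _ _ y])
    then have "x \<in> set (take (?\<alpha> y + 2) xs)" using nb x R by metis
    then obtain k where k: "k < length xs" "k < ?\<alpha> y + 2" "xs ! k = x"
      by (auto simp: in_set_conv_nth)
    then have "?xs ! k = x" "k < h" using lx by (auto simp: nth_append)
    then have "?\<beta> x = k" using bB by (metis bij_betw_def lessThan_iff the_inv_into_f_f)
    with k show "?\<beta> x \<le> ?\<alpha> y + 1" by simp
  qed
qed

section \<open>Exchange sets between two classes of unequal size\<close>

text \<open>Closed pairs are unions of components of the bipartite graph of \<open>R\<close>. Each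
  \<open>y\<close> joins at most two elements of \<open>P\<close>, so a component with
  \<open>k\<close> elements of \<open>Q\<close> has at most \<open>k + 1\<close> of
  \<open>P\<close>, and a component with positive excess has excess exactly one. A closed pair of
  positive excess and least total size takes the place of such a component.\<close>

lemma closed_pair_excess_one:
  fixes R :: "'b \<Rightarrow> 'c \<Rightarrow> bool"
  assumes fin: "finite P" "finite Q" and less: "card Q < card P"
    and degQ: "\<And>y. y \<in> Q \<Longrightarrow> card {x \<in> P. R x y} \<le> 2"
  obtains X Y where "X \<subseteq> P" "Y \<subseteq> Q" "card X = card Y + 1"
    "\<And>x y. x \<in> P \<Longrightarrow> y \<in> Q \<Longrightarrow> R x y \<Longrightarrow> x \<in> X \<longleftrightarrow> y \<in> Y"
proof -
  define C where "C = (\<lambda>(X, Y). X \<subseteq> P \<and> Y \<subseteq> Q \<and> card Y < card X \<and>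
    (\<forall>x\<in>P. \<forall>y\<in>Q. R x y \<longrightarrow> (x \<in> X \<longleftrightarrow> y \<in> Y)))"
  have "C (P, Q)" unfolding C_def using less by auto
  then obtain X Y where XY: "C (X, Y)"
    and min: "\<And>X' Y'. C (X', Y') \<Longrightarrow> card X + card Y \<le> card X' + card Y'"
    using ex_has_least_nat[of C "(P, Q)" "\<lambda>(X, Y). card X + card Y"] by auto
  have XYs: "X \<subseteq> P" "Y \<subseteq> Q" "card Y < card X"
    and cl: "\<And>x y. x \<in> P \<Longrightarrow> y \<in> Q \<Longrightarrow> R x y \<Longrightarrow> x \<in> X \<longleftrightarrow> y \<in> Y"
    using XY unfolding C_def by auto
  have finXY: "finite X" "finite Y" using XYs fin by (auto intro: finite_subset)
  show ?thesis
  proof (cases "Y = {}")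
    case True
    \<comment> \<open>As \<open>Y\<close> is empty, closedness leaves the elements of
      \<open>X\<close> without neighbours in \<open>Q\<close>; any one of them is closed on its
      own.\<close>
    obtain x where x: "x \<in> X" using XYs by fastforce
    show ?thesis
    proof (rule that[of "{x}" "{}"])
      show "\<And>x' y. x' \<in> P \<Longrightarrow> y \<in> Q \<Longrightarrow> R x' y \<Longrightarrow> x' \<in> {x} \<longleftrightarrow> y \<in> {}"
        using cl x True by blast
    qed (use x XYs in auto)
  next
    case False
    then obtain y0 where y0: "y0 \<in> Y" by auto
    \<comment> \<open>A maximal \<open>S\<close> with \<open>card (N S) \<le> card S + 1\<close> is closed together with \<open>N S\<close>, since a neighbour
      of \<open>N S\<close> outside \<open>S\<close> would add at most one new neighbour. By minimality of \<open>X\<close> and \<open>Y\<close> the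
      rest has no excess.\<close>
    define N where "N S = {x \<in> P. \<exists>y\<in>S. R x y}" for S
    define F where "F = {S. S \<subseteq> Y \<and> y0 \<in> S \<and> card (N S) \<le> card S + 1}"
    have finN: "finite (N S)" for S using fin by (auto simp: N_def)
    have "N {y0} = {x \<in> P. R x y0}" by (auto simp: N_def)
    then have "{y0} \<in> F" using y0 degQ[of y0] XYs by (auto simp: F_def)
    moreover have "finite F" using finXY by (auto simp: F_def)
    ultimately obtain S where S: "S \<in> F" and max: "\<And>T. T \<in> F \<Longrightarrow> S \<subseteq> T \<Longrightarrow> S = T"
      using finite_has_maximal[of F] by blast
    have SY: "S \<subseteq> Y" "y0 \<in> S" "card (N S) \<le> card S + 1" "finite S"
      using S finXY by (auto simp: F_def intro: finite_subset)
    have NX: "N S \<subseteq> X" using SY XYs cl unfolding N_def by blast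
    have clS: "y \<in> S" if "x \<in> N S" "y \<in> Q" "R x y" for x y
    proof (rule ccontr)
      assume ny: "y \<notin> S"
      have xP: "x \<in> P" using that by (auto simp: N_def)
      have yY: "y \<in> Y" using that NX cl xP by blast
      have "N (insert y S) = N S \<union> ({x \<in> P. R x y} - {x})"
        using that by (auto simp: N_def)
      moreover have "card ({x \<in> P. R x y} - {x}) \<le> 1"
        using degQ[of y] that xP fin by simp
      ultimately have "card (N (insert y S)) \<le> card S + 2"
        using SY(3) card_Un_le[of "N S" "{x \<in> P. R x y} - {x}"] by simp
      then have "insert y S \<in> F" using SY ny yY by (auto simp: F_def)
      then show False using max ny by blast
    qed
    have "\<not> C (X - N S, Y - S)"
    proof
      assume "C (X - N S, Y - S)"
      then have "card X + card Y \<le> card (X - N S) + card (Y - S)" by (rule min)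
      moreover have "card (X - N S) \<le> card X" using finXY by (intro card_mono) auto
      moreover have "card (Y - S) < card Y" using finXY y0 SY by (intro psubset_card_mono) auto
      ultimately show False by simp
    qed
    moreover have "x \<in> X - N S \<longleftrightarrow> y \<in> Y - S" if "x \<in> P" "y \<in> Q" "R x y" for x y
      using cl[OF that] clS[OF _ that(2,3)] that by (auto simp: N_def)
    ultimately have "card (X - N S) \<le> card (Y - S)"
      using XYs unfolding C_def by auto
    then have "card X - card (N S) \<le> card Y - card S"
      using NX SY finN by (simp add: card_Diff_subset)
    moreover have "card S \<le> card Y" using SY finXY by (intro card_mono) auto
    ultimately have "card X = card Y + 1" using SY(3) XYs(3) by linarith
    then show ?thesis using that XYs cl by blast
  qed
qed

section \<open>Balanced edge colourings\<close>

lemma adjacent_sym: "adjacent e e' \<Longrightarrow> adjacent e' e"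
  by (auto simp: adjacent_def)

text \<open>Choosing a common vertex with \<open>e\<close> is injective on the members of
  \<open>M\<close> that are adjacent to \<open>e\<close>, because two distinct members through one
  vertex would be adjacent. For \<open>card e = 2\<close> this is the degree bound between two
  colour classes.\<close>

lemma card_adjacent_in_matching:
  assumes e: "finite e" and M: "\<And>x y. x \<in> M \<Longrightarrow> y \<in> M \<Longrightarrow> \<not> adjacent x y"
  shows "card {x \<in> M. adjacent x e} \<le> card e"
proof -
  define v where "v x = (SOME u. u \<in> x \<inter> e)" for x
  have v: "v x \<in> x \<inter> e" if "adjacent x e" for x
    using that unfolding v_def some_in_eq by (simp add: adjacent_def)
  have "inj_on v {x \<in> M. adjacent x e}"
  proof (rule inj_onI)
    fix x y assume a: "x \<in> {x \<in> M. adjacent x e}" "y \<in> {x \<in> M. adjacent x e}" "v x = v y"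
    then have "x \<inter> y \<noteq> {}" using v[of x] v[of y] by auto
    then show "x = y" using M[of x y] a by (auto simp: adjacent_def)
  qed
  then show ?thesis using v e by (intro card_inj_on_le) auto
qed

text \<open>Induction on the total deficit of the classes below \<open>t\<close>. If some class
  \<open>j\<close> is too small, averaging with \<open>t * c \<le> card E\<close> gives a class
  \<open>i\<close> with more than \<open>t\<close> edges, and an exchange of excess one moves
  exactly one edge's worth of size from \<open>i\<close> to \<open>j\<close>.\<close>

lemma balanced_colouring:
  assumes fin: "finite E" and c2: "\<And>e. e \<in> E \<Longrightarrow> card e = 2" and t: "t * c \<le> card E"
  shows "proper_edge_colouring E f \<Longrightarrow> f ` E \<subseteq> {..<c} \<Longrightarrow>
    \<exists>g. proper_edge_colouring E g \<and> g ` E \<subseteq> {..<c} \<and> (\<forall>i<c. t \<le> card {e \<in> E. g e = i})"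
proof (induction "\<Sum>i<c. t - card {e \<in> E. f e = i}" arbitrary: f rule: less_induct)
  case less
  let ?n = "\<lambda>i. card {e \<in> E. f e = i}"
  have E: "card E = (\<Sum>i<c. ?n i)"
  proof -
    have "E = (\<Union>i\<in>{..<c}. {e \<in> E. f e = i})" using less.prems by auto
    then have "card E = card (\<Union>i\<in>{..<c}. {e \<in> E. f e = i})" by simp
    also have "\<dots> = (\<Sum>i<c. ?n i)" using fin by (intro card_UN_disjoint) auto
    finally show ?thesis .
  qed
  show ?case
  proof (cases "\<forall>i<c. t \<le> ?n i")
    case True
    then show ?thesis using less.prems by blast
  next
    case False
    then obtain j where j: "j < c" "?n j < t" by auto
    have "\<exists>i<c. t < ?n i"
    proof (rule ccontr)
      assume "\<not> ?thesis"
      then have "(\<Sum>i<c. ?n i) < (\<Sum>i<c. t)" using j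
        by (intro sum_strict_mono_ex1) (auto simp: not_less[symmetric])
      then show False using t E by (simp add: mult.commute)
    qed
    then obtain i where i: "i < c" "t < ?n i" by auto
    have ij: "i \<noteq> j" using i j by auto
    let ?P = "{e \<in> E. f e = i}" and ?Q = "{e \<in> E. f e = j}"
    have ne_col: "\<And>x y. x \<in> E \<Longrightarrow> y \<in> E \<Longrightarrow> adjacent x y \<Longrightarrow> f x \<noteq> f y"
      using less.prems by (auto simp: proper_edge_colouring_def)
    have deg: "card {x \<in> ?P. adjacent x y} \<le> 2" if "y \<in> ?Q" for y
    proof -
      have y: "card y = 2" using c2 that by simp
      then have fy: "finite y" by (metis card.infinite zero_neq_numeral)
      have "\<not> adjacent x x'" if "x \<in> ?P" "x' \<in> ?P" for x x'
        using ne_col[of x x'] that by auto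
      then show ?thesis
        using card_adjacent_in_matching[OF fy, of ?P] y by simp
    qed
    obtain X Y where XY: "X \<subseteq> ?P" "Y \<subseteq> ?Q" "card X = card Y + 1"
      and cl: "\<And>x y. x \<in> ?P \<Longrightarrow> y \<in> ?Q \<Longrightarrow> adjacent x y \<Longrightarrow> x \<in> X \<longleftrightarrow> y \<in> Y"
    proof (rule closed_pair_excess_one[of ?P ?Q adjacent])
      show "card ?Q < card ?P" using i j by simp
    qed (use fin deg in auto)
    define g where "g e = (if e \<in> X then j else if e \<in> Y then i else f e)" for e
    have disj: "X \<inter> Y = {}" using XY ij by auto
    have finXY: "finite X" "finite Y" using XY fin by (auto intro: finite_subset)
    have gi: "{e \<in> E. g e = i} = (?P - X) \<union> Y" and gj: "{e \<in> E. g e = j} = (?Q - Y) \<union> X"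
      using XY ij disj by (auto simp: g_def)
    have gk: "{e \<in> E. g e = k} = {e \<in> E. f e = k}" if "k \<noteq> i" "k \<noteq> j" for k
      using XY that by (auto simp: g_def)
    have "card X \<le> ?n i" "card Y \<le> ?n j" using card_mono[OF _ XY(1)] card_mono[OF _ XY(2)] fin by simp_all
    moreover have "card {e \<in> E. g e = i} = ?n i - card X + card Y"
      unfolding gi using XY fin finXY ij
      by (subst card_Un_disjoint) (force simp: card_Diff_subset)+
    moreover have "card {e \<in> E. g e = j} = ?n j - card Y + card X"
      unfolding gj using XY fin finXY ij
      by (subst card_Un_disjoint) (force simp: card_Diff_subset)+
    ultimately have ni: "card {e \<in> E. g e = i} = ?n i - 1"
      and nj: "card {e \<in> E. g e = j} = ?n j + 1" using XY(3) by auto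
    have "(\<Sum>k<c. t - card {e \<in> E. g e = k}) < (\<Sum>k<c. t - ?n k)"
    proof (rule sum_strict_mono_ex1)
      show "\<forall>k\<in>{..<c}. t - card {e \<in> E. g e = k} \<le> t - ?n k"
      proof
        fix k
        \<comment> \<open>Class \<open>i\<close> had more than \<open>t\<close> edges, so losing one
          leaves its deficit at zero.\<close>
        show "t - card {e \<in> E. g e = k} \<le> t - ?n k"
          using ni nj i by (cases "k = i"; cases "k = j") (auto simp: gk)
      qed
      show "\<exists>k\<in>{..<c}. t - card {e \<in> E. g e = k} < t - ?n k"
        using nj j by (intro bexI[of _ j]) auto
    qed simp
    moreover have "proper_edge_colouring E g"
      unfolding proper_edge_colouring_def
    proof (intro ballI impI)
      fix e e' assume e: "e \<in> E" "e' \<in> E" "adjacent e e'"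
      have ne: "f e \<noteq> f e'" by (rule ne_col[OF e])
      have X: "x \<in> X \<Longrightarrow> f x = i" and Y: "x \<in> Y \<Longrightarrow> f x = j" for x using XY by auto
      \<comment> \<open>A clash could only arise between an edge of colour \<open>i\<close> and an
        adjacent one of colour \<open>j\<close>; closedness makes such a pair change colours
        together or not at all.\<close>
      have 1: "f e = i \<Longrightarrow> f e' = j \<Longrightarrow> e \<in> X \<longleftrightarrow> e' \<in> Y" using cl[of e e'] e by simp
      have 2: "f e' = i \<Longrightarrow> f e = j \<Longrightarrow> e' \<in> X \<longleftrightarrow> e \<in> Y"
        using cl[of e' e] adjacent_sym[OF e(3)] e by simp
      show "g e \<noteq> g e'"
        unfolding g_def using ne X[of e] X[of e'] Y[of e] Y[of e'] 1 2 ij by (auto split: if_splits)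
    qed
    moreover have "g ` E \<subseteq> {..<c}" using less.prems i j by (auto simp: g_def)
    ultimately show ?thesis by (intro less.hyps) auto
  qed
qed

section \<open>The parameter cms\<close>

lemma cyc_dist_props:
  assumes l: "edge_ordering E l" and fin: "finite E" and e: "e \<in> E" "e' \<in> E"
  shows cyc_dist_pos: "0 < cyc_dist E l e e'"
    and cyc_dist_cong: "[l e + cyc_dist E l e e' = l e'] (mod card E)"
proof -
  have le: "l e < card E" using l e by (auto simp: edge_ordering_def bij_betw_def)
  have "0 < l e' + card E - l e \<and> [l e + (l e' + card E - l e) = l e'] (mod card E)"
    using le by (simp add: cong_def)
  then have "0 < cyc_dist E l e e' \<and> [l e + cyc_dist E l e e' = l e'] (mod card E)"
    unfolding cyc_dist_def by (rule LeastI)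
  then show "0 < cyc_dist E l e e'" "[l e + cyc_dist E l e e' = l e'] (mod card E)" by auto
qed

lemma cyc_dist_le: "0 < d \<Longrightarrow> [l e + d = l e'] (mod card E) \<Longrightarrow> cyc_dist E l e e' \<le> d"
  unfolding cyc_dist_def by (rule Least_le) simp

lemma ex_edge_ordering: "finite E \<Longrightarrow> \<exists>l. edge_ordering E l"
  unfolding edge_ordering_def using ex_bij_betw_finite_nat[of E] by (simp add: atLeast0LessThan)

lemma cms_ordering_props:
  assumes l: "edge_ordering E l" and fin: "finite E" and ne: "E \<noteq> {}"
  shows "cms_ordering E l \<in> {s \<in> {1..card E}.
     \<forall>e\<in>E. \<forall>e'\<in>E. adjacent e e' \<longrightarrow> s \<le> cyc_dist_sym E l e e'}" (is "_ \<in> ?S")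
proof -
  have "1 \<le> cyc_dist_sym E l e e'" if "e \<in> E" "e' \<in> E" for e e'
    using cyc_dist_pos[OF l fin that] cyc_dist_pos[OF l fin that(2,1)]
    by (simp add: cyc_dist_sym_def)
  moreover have "1 \<le> card E" using fin ne by (simp add: Suc_le_eq card_gt_0_iff)
  ultimately have "1 \<in> ?S" by simp
  then have "?S \<noteq> {}" by blast
  then show ?thesis unfolding cms_ordering_def by (intro Max_in) auto
qed

lemma finite_cms_orderings:
  assumes "finite E" "E \<noteq> {}"
  shows "finite {cms_ordering E l | l. edge_ordering E l}"
proof (rule finite_subset)
  show "{cms_ordering E l | l. edge_ordering E l} \<subseteq> {..card E}"
  proof
    fix s assume "s \<in> {cms_ordering E l | l. edge_ordering E l}"
    then obtain l where l: "edge_ordering E l" "s = cms_ordering E l" by blast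
    from cms_ordering_props[OF l(1) assms] show "s \<in> {..card E}" by (simp add: l(2))
  qed
qed simp

text \<open>A bound on the directed distance suffices, since the hypothesis also covers the pair in
  reverse order.\<close>

lemma cms_geI:
  assumes l: "edge_ordering E l" and fin: "finite E" and ne: "E \<noteq> {}" and s: "s \<in> {1..card E}"
    and dist: "\<And>e e'. e \<in> E \<Longrightarrow> e' \<in> E \<Longrightarrow> adjacent e e' \<Longrightarrow> s \<le> cyc_dist E l e e'"
  shows "s \<le> cms E"
proof -
  have "s \<le> cyc_dist_sym E l e e'" if "e \<in> E" "e' \<in> E" "adjacent e e'" for e e'
    using dist[OF that] dist[OF that(2,1) adjacent_sym[OF that(3)]] by (simp add: cyc_dist_sym_def)
  then have "s \<le> cms_ordering E l"
    unfolding cms_ordering_def using s by (intro Max_ge) auto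
  also have "\<dots> \<le> cms E"
    unfolding cms_def using finite_cms_orderings[OF fin ne] l by (intro Max_ge) auto
  finally show ?thesis .
qed

lemma cms_attained:
  assumes fin: "finite E" and ne: "E \<noteq> {}"
  obtains l where "edge_ordering E l" "1 \<le> cms E" "cms E \<le> card E"
    "\<And>e e'. e \<in> E \<Longrightarrow> e' \<in> E \<Longrightarrow> adjacent e e' \<Longrightarrow> cms E \<le> cyc_dist E l e e'"
proof -
  have "cms E \<in> {cms_ordering E l | l. edge_ordering E l}"
    unfolding cms_def using finite_cms_orderings[OF fin ne] ex_edge_ordering[OF fin]
    by (intro Max_in) auto
  then obtain l where l: "edge_ordering E l" "cms E = cms_ordering E l" by auto
  have "cms E \<in> {s \<in> {1..card E}. \<forall>e\<in>E. \<forall>e'\<in>E. adjacent e e' \<longrightarrow> s \<le> cyc_dist_sym E l e e'}"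
    unfolding l(2) by (rule cms_ordering_props[OF l(1) fin ne])
  then show ?thesis by (intro that[OF l(1)]) (auto simp: cyc_dist_sym_def)
qed

section \<open>The upper bound\<close>

lemma mod_less_double: "a < 2 * m \<Longrightarrow> a mod m = (if a < m then a else a - m)" for a m :: nat
  by (simp add: le_mod_geq)

text \<open>Counts the starting points \<open>i\<close> whose cyclic window of length
  \<open>s\<close> covers position \<open>p\<close>. Reflection \<open>i \<mapsto> p - i\<close>
  modulo \<open>m\<close> is an involution, so it maps these starting points bijectively to
  \<open>{..<s}\<close>.\<close>

lemma card_window:
  fixes m s p :: nat
  assumes "p < m" "s \<le> m"
  shows "card {i \<in> {..<m}. (p + m - i) mod m < s} = s"
proof -
  let ?f = "\<lambda>i. (p + m - i) mod m"
  have inv: "?f (?f i) = i" if "i < m" for i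
  proof (cases "i \<le> p")
    case True
    then have "?f i = p - i" using assms(1) by (simp add: mod_less_double less_imp_diff_less)
    then show ?thesis using True that by simp
  next
    case False
    then have "?f i = p + m - i" using assms that by (simp add: mod_less_double)
    then show ?thesis using False that by simp
  qed
  have lt: "?f i < m" for i using assms by simp
  have "bij_betw ?f {i \<in> {..<m}. ?f i < s} {..<s}"
    using inv lt assms(2) by (intro bij_betw_byWitness[of _ ?f]) auto
  then show ?thesis using bij_betw_same_card by fastforce
qed

text \<open>The matchings through one fixed edge already have total weight at least 1. This bounds
  the infimum away from zero, so that dividing by it is legitimate.\<close>

lemma fractional_chromatic_index_ge_1:
  assumes fin: "finite E" and ne: "E \<noteq> {}" and w: "fractional_edge_colouring E w"
  shows "1 \<le> (\<Sum>M\<in>matchings E. w M)"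
proof -
  have finM: "finite (matchings E)"
    by (rule finite_subset[of _ "Pow E"]) (use fin in \<open>auto simp: matchings_def\<close>)
  obtain e where "e \<in> E" using ne by auto
  then have "1 \<le> (\<Sum>M\<in>{M \<in> matchings E. e \<in> M}. w M)"
    using w by (auto simp: fractional_edge_colouring_def)
  also have "\<dots> \<le> (\<Sum>M\<in>matchings E. w M)"
    using finM w by (intro sum_mono2) (auto simp: fractional_edge_colouring_def)
  finally show ?thesis .
qed

lemma fractional_chromatic_index_bounds:
  assumes fin: "finite E" and ne: "E \<noteq> {}"
    and l: "edge_ordering E l" and s: "1 \<le> s" "s \<le> card E"
    and dist: "\<And>e e'. e \<in> E \<Longrightarrow> e' \<in> E \<Longrightarrow> adjacent e e' \<Longrightarrow> s \<le> cyc_dist E l e e'"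
  shows "1 \<le> fractional_chromatic_index E" "fractional_chromatic_index E \<le> card E / s"
proof -
  let ?m = "card E"
  have finM: "finite (matchings E)"
    by (rule finite_subset[of _ "Pow E"]) (use fin in \<open>auto simp: matchings_def\<close>)
  have lE: "l e < ?m" if "e \<in> E" for e
    using l that by (auto simp: edge_ordering_def bij_betw_def)
  have linj: "l e = l e' \<Longrightarrow> e = e'" if "e \<in> E" "e' \<in> E" for e e'
    using l that by (auto simp: edge_ordering_def bij_betw_def inj_on_def)
  \<comment> \<open>\<open>W i\<close> consists of the edges at the \<open>s\<close> cyclically
    consecutive positions starting from \<open>i\<close>.\<close>
  define W where "W i = {e \<in> E. (l e + ?m - i) mod ?m < s}" for i
  \<comment> \<open>Different starting points can give the same set, for instance when
    \<open>s = card E\<close>, so the windows are counted with multiplicity.\<close>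
  define w where "w M = card {i \<in> {..<?m}. W i = M} / s" for M
  have W: "W i \<in> matchings E" if i: "i < ?m" for i
  proof -
    have "\<not> adjacent e e'" if ee: "e \<in> W i" "e' \<in> W i"
      and le: "(l e + ?m - i) mod ?m \<le> (l e' + ?m - i) mod ?m" for e e'
    proof
      assume adj: "adjacent e e'"
      have E: "e \<in> E" "e' \<in> E" and lt: "(l e' + ?m - i) mod ?m < s"
        using ee by (auto simp: W_def)
      \<comment> \<open>The difference of the two offsets is below \<open>s\<close> and leads from
        \<open>l e\<close> to \<open>l e'\<close>. Once shown positive, it bounds the cyclic
        distance and contradicts \<open>dist\<close>.\<close>
      define d where "d = (l e' + ?m - i) mod ?m - (l e + ?m - i) mod ?m"
      have r: "[(l x + ?m - i) mod ?m + i = l x] (mod ?m)" for x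
        using i by (simp add: cong_def mod_simps)
      have "[l e + d = ((l e + ?m - i) mod ?m + i) + d] (mod ?m)"
        using cong_sym[OF r] by (rule cong_add) simp
      also have "((l e + ?m - i) mod ?m + i) + d = (l e' + ?m - i) mod ?m + i"
        using le by (simp add: d_def)
      also note r
      finally have c: "[l e + d = l e'] (mod ?m)" .
      have "l e \<noteq> l e'" using E linj adj by (auto simp: adjacent_def)
      then have "0 < d" using c lE[OF E(1)] lE[OF E(2)] by (cases d) (auto simp: cong_def)
      then have "cyc_dist E l e e' \<le> d" using c by (rule cyc_dist_le)
      with dist[OF E adj] lt show False by (simp add: d_def)
    qed
    then have "\<not> adjacent e e'" if "e \<in> W i" "e' \<in> W i" for e e'
      using that adjacent_sym nat_le_linear by metis
    then show ?thesis by (auto simp: matchings_def W_def)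
  qed
  have sum: "(\<Sum>M\<in>F. w M) = card {i \<in> {..<?m}. W i \<in> F} / s" if "finite F" for F
  proof -
    have "(\<Sum>M\<in>F. card {i \<in> {..<?m}. W i = M}) = card (\<Union>M\<in>F. {i \<in> {..<?m}. W i = M})"
      using that by (intro card_UN_disjoint[symmetric]) auto
    also have "(\<Union>M\<in>F. {i \<in> {..<?m}. W i = M}) = {i \<in> {..<?m}. W i \<in> F}" by auto
    finally have eq: "(\<Sum>M\<in>F. card {i \<in> {..<?m}. W i = M}) = card {i \<in> {..<?m}. W i \<in> F}" .
    have "(\<Sum>M\<in>F. w M) = real (\<Sum>M\<in>F. card {i \<in> {..<?m}. W i = M}) / s"
      by (simp add: w_def sum_divide_distrib)
    then show ?thesis by (simp only: eq)
  qed
  have cov: "(\<Sum>M\<in>{M \<in> matchings E. e \<in> M}. w M) = 1" if e: "e \<in> E" for e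
  proof -
    have "{i \<in> {..<?m}. W i \<in> {M \<in> matchings E. e \<in> M}} = {i \<in> {..<?m}. (l e + ?m - i) mod ?m < s}"
      using W e by (auto simp: W_def)
    then show ?thesis using sum[of "{M \<in> matchings E. e \<in> M}"] finM card_window[OF lE[OF e] s(2)] s
      by simp
  qed
  have fw: "fractional_edge_colouring E w"
    unfolding fractional_edge_colouring_def using cov by (auto simp: w_def)
  have "{i \<in> {..<?m}. W i \<in> matchings E} = {..<?m}" using W by auto
  then have tot: "(\<Sum>M\<in>matchings E. w M) = ?m / s" using sum[OF finM] by simp
  let ?S = "{\<Sum>M\<in>matchings E. w M | w. fractional_edge_colouring E w}"
  have ge1: "\<And>x. x \<in> ?S \<Longrightarrow> 1 \<le> x" using fractional_chromatic_index_ge_1[OF fin ne] by auto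
  show "1 \<le> fractional_chromatic_index E"
    unfolding fractional_chromatic_index_def using fw by (intro cInf_greatest ge1) auto
  have "?m / s \<in> ?S" using fw tot by (intro CollectI exI[of _ w]) simp
  then show "fractional_chromatic_index E \<le> ?m / s"
    unfolding fractional_chromatic_index_def using ge1 by (intro cInf_lower bdd_belowI) auto
qed

lemma cms_upper_bound:
  assumes "finite E" "E \<noteq> {}"
  shows "real (cms E) \<le> 1 / fractional_chromatic_index E * real (card E)"
proof -
  obtain l where l: "edge_ordering E l" "1 \<le> cms E" "cms E \<le> card E"
    "\<And>e e'. e \<in> E \<Longrightarrow> e' \<in> E \<Longrightarrow> adjacent e e' \<Longrightarrow> cms E \<le> cyc_dist E l e e'"
    by (rule cms_attained[OF assms]) blast
  from fractional_chromatic_index_bounds[OF assms l] l(2) show ?thesis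
    by (simp add: field_simps)
qed

section \<open>A star with one additional edge\<close>

definition star_plus :: "nat \<Rightarrow> nat set set" where
  "star_plus n = insert {1, 2} ((\<lambda>i. {0, i}) ` {1..<n})"

lemma card_star_plus:
  assumes "3 \<le> n"
  shows "card (star_plus n) = n"
proof -
  have "inj_on (\<lambda>i. {0, i}) {1..<n}" by (auto simp: inj_on_def doubleton_eq_iff)
  then have "card ((\<lambda>i. {0, i}) ` {1..<n}) = n - 1" by (simp add: card_image)
  moreover have "{1, 2} \<notin> (\<lambda>i. {0::nat, i}) ` {1..<n}" by (auto simp: doubleton_eq_iff)
  ultimately show ?thesis using assms by (simp add: star_plus_def)
qed

lemma cms_star_plus:
  assumes n: "3 \<le> n"
  shows "cms (star_plus n) = 1"
proof -
  let ?E = "star_plus n"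
  have E: "finite ?E" "?E \<noteq> {}" by (auto simp: star_plus_def)
  obtain l where l: "edge_ordering ?E l" "1 \<le> cms ?E"
    "\<And>e e'. e \<in> ?E \<Longrightarrow> e' \<in> ?E \<Longrightarrow> adjacent e e' \<Longrightarrow> cms ?E \<le> cyc_dist ?E l e e'"
    by (rule cms_attained[OF E]) blast
  have im: "l ` ?E = {..<n}"
    using l(1) n by (simp add: edge_ordering_def bij_betw_def card_star_plus)
  define p where "p = l {1, 2}"
  have "{1, 2} \<in> ?E" by (simp add: star_plus_def)
  then have p: "p < n" using im by (auto simp: p_def)
  \<comment> \<open>For \<open>n \<ge> 3\<close> the positions \<open>p\<close>,
    \<open>p + 1\<close> and \<open>p + 2\<close> are distinct modulo \<open>n\<close>, so the two
    edges found are distinct star edges and share the centre \<open>0\<close>.\<close>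
  have "(p + 1) mod n < n" "(p + 2) mod n < n" using n by auto
  then obtain e e' where e: "e \<in> ?E" "l e = (p + 1) mod n" and e': "e' \<in> ?E" "l e' = (p + 2) mod n"
    using im by (metis imageE lessThan_iff)
  have "l e \<noteq> p" "l e' \<noteq> p" "l e \<noteq> l e'"
    using p n unfolding e e' by (auto simp: mod_less_double split: if_splits)
  then have "e \<noteq> {1, 2}" "e' \<noteq> {1, 2}" "e \<noteq> e'" by (auto simp: p_def)
  then have "adjacent e e'" using e(1) e'(1) by (auto simp: adjacent_def star_plus_def)
  moreover have "cyc_dist ?E l e e' \<le> 1"
    using n by (intro cyc_dist_le) (auto simp: e e' card_star_plus cong_def mod_simps)
  ultimately show ?thesis using l(2) l(3)[OF e(1) e'(1)] by linarith
qed

lemma simple_graph_star_plus: "3 \<le> n \<Longrightarrow> simple_graph {..<n} (star_plus n)"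
  by (auto simp: simple_graph_def star_plus_def)

section \<open>The lower bound\<close>

text \<open>Adding the sizes of all earlier classes puts each class into its own block of
  consecutive positions. Blocks are disjoint, which gives injectivity; surjectivity follows by
  counting.\<close>

lemma edge_ordering_from_local_positions:
  fixes g :: "'a set \<Rightarrow> nat" and p :: "'a set \<Rightarrow> nat"
  assumes fin: "finite E" and gc: "g ` E \<subseteq> {..<c}"
    and n: "\<And>i. n i = card {e \<in> E. g e = i}"
    and p: "\<And>e. e \<in> E \<Longrightarrow> p e < n (g e)"
    and inj: "\<And>i. inj_on p {e \<in> E. g e = i}"
  shows "card E = (\<Sum>i<c. n i)" "edge_ordering E (\<lambda>e. (\<Sum>i<g e. n i) + p e)"
proof -
  let ?l = "\<lambda>e. (\<Sum>i<g e. n i) + p e"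
  have "E = (\<Union>i\<in>{..<c}. {e \<in> E. g e = i})" using gc by auto
  then have "card E = card (\<Union>i\<in>{..<c}. {e \<in> E. g e = i})" by simp
  also have "\<dots> = (\<Sum>i<c. n i)" using fin unfolding n by (intro card_UN_disjoint) auto
  finally show cE: "card E = (\<Sum>i<c. n i)" .
  have mono: "(\<Sum>i<a. n i) \<le> (\<Sum>i<b. n i)" if "a \<le> b" for a b
    using that by (intro sum_mono2) auto
  have lt: "?l e < (\<Sum>i<Suc (g e). n i)" if "e \<in> E" for e using p[OF that] by simp
  have less: "?l e < ?l e'" if "e \<in> E" "g e < g e'" for e e'
    using lt[OF that(1)] mono[of "Suc (g e)" "g e'"] that(2) by linarith
  have "inj_on ?l E"
  proof (rule inj_onI)
    fix e e' assume e: "e \<in> E" "e' \<in> E" and eq: "?l e = ?l e'"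
    then have "g e = g e'" using less[of e e'] less[of e' e] by (metis less_irrefl linorder_neqE_nat)
    then show "e = e'" using eq e inj[of "g e"] by (auto simp: inj_on_def)
  qed
  moreover have "?l ` E \<subseteq> {..<card E}"
  proof (rule image_subsetI)
    fix e assume e: "e \<in> E"
    then have "Suc (g e) \<le> c" using gc by auto
    from mono[OF this] lt[OF e] show "?l e \<in> {..<card E}" by (simp add: cE)
  qed
  ultimately have "?l ` E = {..<card E}"
    by (intro card_subset_eq) (auto simp: card_image)
  then show "edge_ordering E ?l" unfolding edge_ordering_def bij_betw_def using \<open>inj_on ?l E\<close> by simp
qed

text \<open>The class laid out just before class \<open>j\<close> on the cycle. The case
  \<open>j = 0\<close> is the wrap-around to the last class; for \<open>c = 1\<close> the only class
  precedes itself.\<close>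

definition cyc_pred :: "nat \<Rightarrow> nat \<Rightarrow> nat" where
  "cyc_pred c j = (if j = 0 then c - 1 else j - 1)"

text \<open>Each colour class \<open>i\<close> is laid out as a head \<open>A i\<close> of \<open>h\<close> edges, an arbitrary middle part,
  and a tail \<open>B i\<close> of \<open>h\<close> edges. A head only has to be coordinated with the tail of the
  preceding class, so all these choices are independent of each other.\<close>

lemma ex_local_positions:
  assumes fin: "finite E" and c2: "\<And>e. e \<in> E \<Longrightarrow> card e = 2"
    and g: "proper_edge_colouring E g" "g ` E \<subseteq> {..<c}"
    and n: "\<And>i. n i = card {e \<in> E. g e = i}"
    and h: "\<And>i. i < c \<Longrightarrow> 2 * h \<le> n i"
  obtains p :: "'a set \<Rightarrow> nat" where
    "\<And>e. e \<in> E \<Longrightarrow> p e < n (g e)"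
    "\<And>i. inj_on p {e \<in> E. g e = i}"
    "\<And>e e'. e \<in> E \<Longrightarrow> e' \<in> E \<Longrightarrow> adjacent e e' \<Longrightarrow> g e = cyc_pred c (g e') \<Longrightarrow>
       h \<le> n (g e) - p e + p e' + 1"
proof -
  let ?M = "\<lambda>i. {e \<in> E. g e = i}"
  have finM: "finite (?M i)" for i using fin by auto
  have nadj: "\<not> adjacent x y" if "x \<in> ?M i" "y \<in> ?M i" for x y i
  proof
    assume "adjacent x y"
    then have "g x \<noteq> g y" using that g(1) unfolding proper_edge_colouring_def by blast
    with that show False by simp
  qed
  have deg: "card {x \<in> S. adjacent x y} \<le> 2" if "S \<subseteq> ?M i" "y \<in> E" for S y i
  proof -
    have cy: "card y = 2" using c2[OF that(2)] .
    then have fy: "finite y" by (metis card.infinite zero_neq_numeral)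
    have "\<not> adjacent x x'" if "x \<in> S" "x' \<in> S" for x x'
      using nadj[of x i x'] that \<open>S \<subseteq> ?M i\<close> by blast
    from card_adjacent_in_matching[OF fy this] cy show ?thesis by simp
  qed
  define split where "split i A B \<longleftrightarrow>
    A \<subseteq> ?M i \<and> B \<subseteq> ?M i \<and> A \<inter> B = {} \<and> card A = h \<and> card B = h" for i A B
  have "\<exists>A B. split i A B" if i: "i < c" for i
  proof -
    have hi: "2 * h \<le> card (?M i)" using h[OF i] unfolding n .
    then have "h \<le> card (?M i)" by linarith
    then obtain A where A: "A \<subseteq> ?M i" "card A = h" "finite A"
      by (rule obtain_subset_with_card_n)
    have "h \<le> card (?M i - A)" using A(2) hi card_Diff_subset[OF A(3,1)] by linarith
    then obtain B where B: "B \<subseteq> ?M i - A" "card B = h"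
      by (rule obtain_subset_with_card_n)
    then have "B \<subseteq> ?M i" "A \<inter> B = {}" by blast+
    with A B show ?thesis unfolding split_def by blast
  qed
  then obtain A B where "\<And>i. i < c \<Longrightarrow> split i (A i) (B i)" by metis
  then have A: "\<And>i. i < c \<Longrightarrow> A i \<subseteq> ?M i" "\<And>i. i < c \<Longrightarrow> card (A i) = h"
    and B: "\<And>i. i < c \<Longrightarrow> B i \<subseteq> ?M i" "\<And>i. i < c \<Longrightarrow> card (B i) = h"
    and AB: "\<And>i. i < c \<Longrightarrow> A i \<inter> B i = {}"
    unfolding split_def by simp_all
  have pred: "cyc_pred c j < c" if "j < c" for j using that by (auto simp: cyc_pred_def)
  define pairing where "pairing j \<beta> \<alpha> \<longleftrightarrow>
    bij_betw \<beta> (B (cyc_pred c j)) {..<h} \<and> bij_betw \<alpha> (A j) {..<h} \<and>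
    (\<forall>x\<in>B (cyc_pred c j). \<forall>y\<in>A j. adjacent x y \<longrightarrow> \<beta> x \<le> \<alpha> y + (1::nat))" for j \<beta> \<alpha>
  have "\<exists>\<beta> \<alpha>. pairing j \<beta> \<alpha>" if j: "j < c" for j
  proof -
    let ?B = "B (cyc_pred c j)"
    have sub: "A j \<subseteq> ?M j" "?B \<subseteq> ?M (cyc_pred c j)" using A B j pred by auto
    have degA: "card {x \<in> ?B. adjacent x y} \<le> 2" if "y \<in> A j" for y
      using deg[OF sub(2)] that sub by auto
    have degB: "card {y \<in> A j. adjacent x y} \<le> 2" if "x \<in> ?B" for x
    proof -
      have "{y \<in> A j. adjacent x y} = {y \<in> A j. adjacent y x}" by (auto intro: adjacent_sym)
      then show ?thesis using deg[OF sub(1), of x] that sub by auto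
    qed
    obtain \<beta> \<alpha> :: "'a set \<Rightarrow> nat" where "bij_betw \<beta> ?B {..<h}" "bij_betw \<alpha> (A j) {..<h}"
      "\<And>x y. x \<in> ?B \<Longrightarrow> y \<in> A j \<Longrightarrow> adjacent x y \<Longrightarrow> \<beta> x \<le> \<alpha> y + 1"
      using paired_enumerations[OF finite_subset[OF sub(1) finM] finite_subset[OF sub(2) finM]
          A(2)[OF j] B(2)[OF pred[OF j]] degA degB] by blast
    then show ?thesis unfolding pairing_def by blast
  qed
  then obtain \<beta>' \<alpha> where "\<And>j. j < c \<Longrightarrow> pairing j (\<beta>' j) (\<alpha> j)" by metis
  then have
    b': "\<And>j. j < c \<Longrightarrow> bij_betw (\<beta>' j) (B (cyc_pred c j)) {..<h}" and
    a: "\<And>j. j < c \<Longrightarrow> bij_betw (\<alpha> j) (A j) {..<h}" and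
    ab': "\<And>j x y. j < c \<Longrightarrow> x \<in> B (cyc_pred c j) \<Longrightarrow> y \<in> A j \<Longrightarrow> adjacent x y \<Longrightarrow>
      \<beta>' j x \<le> \<alpha> j y + (1::nat)"
    unfolding pairing_def by simp_all
  \<comment> \<open>\<open>\<beta>'\<close> is indexed by the class of the head. The cyclic
    successor, inverse to \<open>cyc_pred\<close>, reindexes it by the class whose tail it
    enumerates.\<close>
  define nxt where "nxt i = (if Suc i = c then 0 else Suc i)" for i
  have nxt: "nxt i < c" "cyc_pred c (nxt i) = i" if "i < c" for i
    using that by (auto simp: nxt_def cyc_pred_def)
  have nxt_pred: "nxt (cyc_pred c j) = j" if "j < c" for j
    using that by (auto simp: nxt_def cyc_pred_def)
  define \<beta> where "\<beta> i = \<beta>' (nxt i)" for i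
  have b: "bij_betw (\<beta> i) (B i) {..<h}" if "i < c" for i
    using b'[of "nxt i"] nxt that by (simp add: \<beta>_def)
  have ab: "\<beta> (cyc_pred c j) x \<le> \<alpha> j y + 1"
    if "j < c" "x \<in> B (cyc_pred c j)" "y \<in> A j" "adjacent x y" for j x y
    using ab'[OF that] nxt_pred[OF that(1)] by (simp add: \<beta>_def)
  have "\<exists>\<gamma>. bij_betw \<gamma> (?M i - A i - B i) {..<n i - 2 * h}" if i: "i < c" for i
  proof -
    have "card (?M i - A i - B i) = n i - 2 * h"
    proof -
      have AM: "A i \<union> B i \<subseteq> ?M i" using A(1)[OF i] B(1)[OF i] by simp
      then have fAB: "finite (A i \<union> B i)" by (rule finite_subset[OF _ finM])
      have "card (?M i - (A i \<union> B i)) = n i - card (A i \<union> B i)"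
        unfolding n by (rule card_Diff_subset[OF fAB AM])
      also have "card (A i \<union> B i) = 2 * h"
        using A(2)[OF i] B(2)[OF i] AB[OF i] fAB by (subst card_Un_disjoint) auto
      finally have "card (?M i - (A i \<union> B i)) = n i - 2 * h" .
      moreover have "?M i - A i - B i = ?M i - (A i \<union> B i)" by blast
      ultimately show ?thesis by simp
    qed
    then show ?thesis using ex_bij_betw_finite_nat[of "?M i - A i - B i"] finM
      by (simp add: atLeast0LessThan)
  qed
  then obtain \<gamma> where c: "\<And>i. i < c \<Longrightarrow> bij_betw (\<gamma> i) (?M i - A i - B i) {..<n i - 2 * h}"
    by metis
  \<comment> \<open>The head takes the positions below \<open>h\<close>, the tail the last
    \<open>h\<close> positions of the class, and the middle part those between.\<close>
  define p where "p e = (if e \<in> A (g e) then \<alpha> (g e) e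
    else if e \<in> B (g e) then n (g e) - h + \<beta> (g e) e else h + \<gamma> (g e) e)" for e
  have gE: "g e < c" if "e \<in> E" for e using g that by auto
  have pA: "p e = \<alpha> (g e) e \<and> p e < h" if "e \<in> E" "e \<in> A (g e)" for e
    using that bij_betwE[OF a[OF gE[OF that(1)]]] by (simp add: p_def)
  have pB: "p e = n (g e) - h + \<beta> (g e) e \<and> \<beta> (g e) e < h" if "e \<in> E" "e \<in> B (g e)" for e
  proof -
    have "e \<notin> A (g e)" using AB[OF gE[OF that(1)]] that(2) by blast
    then show ?thesis using that bij_betwE[OF b[OF gE[OF that(1)]]] by (simp add: p_def)
  qed
  have pC: "p e = h + \<gamma> (g e) e \<and> \<gamma> (g e) e < n (g e) - 2 * h"
    if "e \<in> E" "e \<notin> A (g e)" "e \<notin> B (g e)" for e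
    using that bij_betwE[OF c[OF gE[OF that(1)]]] by (simp add: p_def)
  show ?thesis
  proof (rule that)
    show "p e < n (g e)" if e: "e \<in> E" for e
    proof -
      consider "e \<in> A (g e)" | "e \<in> B (g e)" | "e \<notin> A (g e)" "e \<notin> B (g e)" by blast
      then show ?thesis using pA[OF e] pB[OF e] pC[OF e] h[OF gE[OF e]] by cases linarith+
    qed
    show "inj_on p (?M i)" for i
    proof (rule inj_onI)
      fix e e' assume "e \<in> ?M i" "e' \<in> ?M i" and eq: "p e = p e'"
      then have e: "e \<in> E" "g e = i" "e' \<in> E" "g e' = i" by auto
      have i: "i < c" using gE e by auto
      \<comment> \<open>The position alone reveals which of the three parts an edge lies in, so
        injectivity can be checked part by part.\<close>
      have range: "(x \<in> A i \<longleftrightarrow> p x < h) \<and> (x \<in> B i \<longleftrightarrow> n i - h \<le> p x)" if x: "x \<in> E" "g x = i" for x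
      proof -
        consider "x \<in> A i" "x \<notin> B i" | "x \<notin> A i" "x \<in> B i" | "x \<notin> A i" "x \<notin> B i"
          using AB[OF i] by blast
        then show ?thesis
        proof cases
          case 1
          then have "p x < h" using pA[OF x(1)] x(2) by simp
          moreover from this have "p x < n i - h" using h[OF i] by linarith
          ultimately show ?thesis using 1 by simp
        next
          case 2
          then have "n i - h \<le> p x" using pB[OF x(1)] x(2) by simp
          moreover from this have "h \<le> p x" using h[OF i] by linarith
          ultimately show ?thesis using 2 by simp
        next
          case 3
          then have "p x = h + \<gamma> i x" "\<gamma> i x < n i - 2 * h" using pC[OF x(1)] x(2) by simp_all
          then have "h \<le> p x" "p x < n i - h" by linarith+
          then show ?thesis using 3 by simp
        qed
      qed
      have "e \<in> A i \<longleftrightarrow> e' \<in> A i" "e \<in> B i \<longleftrightarrow> e' \<in> B i"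
        using range[OF e(1,2)] range[OF e(3,4)] eq by simp_all
      then consider "e \<in> A i" "e' \<in> A i" | "e \<in> B i" "e' \<in> B i"
        | "e \<in> ?M i - A i - B i" "e' \<in> ?M i - A i - B i"
        using e by blast
      then show "e = e'"
      proof cases
        case 1
        then have "\<alpha> i e = \<alpha> i e'" using pA[of e] pA[of e'] e eq by simp
        then show ?thesis using a[OF i] 1 unfolding bij_betw_def inj_on_def by blast
      next
        case 2
        then have "\<beta> i e = \<beta> i e'" using pB[of e] pB[of e'] e eq by simp
        then show ?thesis using b[OF i] 2 unfolding bij_betw_def inj_on_def by blast
      next
        case 3
        then have "\<gamma> i e = \<gamma> i e'" using pC[of e] pC[of e'] e eq by simp
        then show ?thesis using c[OF i] 3 unfolding bij_betw_def inj_on_def by blast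
      qed
    qed
    fix e e' assume e: "e \<in> E" "e' \<in> E" "adjacent e e'" "g e = cyc_pred c (g e')"
    have hn: "2 * h \<le> n (g e)" by (rule h[OF gE[OF e(1)]])
    show "h \<le> n (g e) - p e + p e' + 1"
    proof (cases "e \<in> B (g e) \<and> e' \<in> A (g e')")
      case True
      \<comment> \<open>Here \<open>n (g e) - p e + p e'\<close> equals
        \<open>h - \<beta> (g e) e + \<alpha> (g e') e'\<close>, so the pairing costs at most one.
        Outside tail and head, one of the two summands is already at least \<open>h\<close>.\<close>
      then have "\<beta> (g e) e \<le> \<alpha> (g e') e' + 1" using ab[OF gE[OF e(2)], of e e'] e(3,4) by metis
      then show ?thesis using True pB[OF e(1)] pA[OF e(2)] hn by linarith
    next
      case False
      then have "e \<notin> B (g e) \<or> e' \<notin> A (g e')" by blast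
      then have "p e < n (g e) - h \<or> h \<le> p e'"
      proof
        assume "e \<notin> B (g e)"
        then show ?thesis
          using pA[OF e(1)] pC[OF e(1)] hn by (cases "e \<in> A (g e)") linarith+
      next
        assume "e' \<notin> A (g e')"
        then show ?thesis
          using pB[OF e(2)] pC[OF e(2)] h[OF gE[OF e(2)]] by (cases "e' \<in> B (g e')") linarith+
      qed
      then show ?thesis by linarith
    qed
  qed
qed

text \<open>Every class has at least \<open>2 * h\<close> edges, so a distance \<open>d\<close> with
  \<open>d + 1 < h\<close> cannot jump over a whole class. Hence \<open>e'\<close> would lie in the
  class cyclically following that of \<open>e\<close>, where \<open>cross\<close> applies.\<close>

lemma ordering_from_colouring:
  assumes fin: "finite E" and c2: "\<And>e. e \<in> E \<Longrightarrow> card e = 2"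
    and g: "proper_edge_colouring E g" "g ` E \<subseteq> {..<c}"
    and h: "\<And>i. i < c \<Longrightarrow> 2 * h \<le> card {e \<in> E. g e = i}"
  obtains l where "edge_ordering E l"
    "\<And>e e'. e \<in> E \<Longrightarrow> e' \<in> E \<Longrightarrow> adjacent e e' \<Longrightarrow> h \<le> cyc_dist E l e e' + 1"
proof -
  define n where "n i = card {e \<in> E. g e = i}" for i
  obtain p where p: "\<And>e. e \<in> E \<Longrightarrow> p e < n (g e)" "\<And>i. inj_on p {e \<in> E. g e = i}"
    and cross: "\<And>e e'. e \<in> E \<Longrightarrow> e' \<in> E \<Longrightarrow> adjacent e e' \<Longrightarrow> g e = cyc_pred c (g e') \<Longrightarrow>
       h \<le> n (g e) - p e + p e' + 1"
    by (rule ex_local_positions[OF fin c2 g n_def, of h]) (use h in \<open>auto simp: n_def\<close>)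
  define s where "s j = (\<Sum>i<j. n i)" for j
  define l where "l e = s (g e) + p e" for e
  have cE: "card E = s c" and l: "edge_ordering E l"
    using edge_ordering_from_local_positions[OF fin g(2) n_def p] unfolding s_def l_def by auto
  have sS: "s (Suc i) = s i + n i" for i by (simp add: s_def)
  have s0: "s 0 = 0" by (simp add: s_def)
  have mono: "s a \<le> s b" if "a \<le> b" for a b
    unfolding s_def using that by (intro sum_mono2) auto
  have gE: "g e < c" if "e \<in> E" for e using g that by auto
  have lt: "l e < s (Suc (g e))" if "e \<in> E" for e using p(1)[OF that] by (simp add: l_def sS)
  have hn: "2 * h \<le> n i" if "i < c" for i using h that by (simp add: n_def)
  have "h \<le> cyc_dist E l e e' + 1" if e: "e \<in> E" "e' \<in> E" and adj: "adjacent e e'" for e e'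
  proof (rule ccontr)
    define d where "d = cyc_dist E l e e'"
    assume "\<not> ?thesis"
    then have d: "d + 1 < h" by (simp add: d_def)
    have cong: "[l e + d = l e'] (mod card E)"
      unfolding d_def by (rule cyc_dist_cong[OF l fin e])
    have gne: "g e \<noteq> g e'" using g(1) e adj by (auto simp: proper_edge_colouring_def)
    have c: "g e < c" "g e' < c" using gE e by auto
    have lm: "l e < card E" "l e' < card E"
      using l e by (auto simp: edge_ordering_def bij_betw_def)
    have "n (g e) \<le> card E" unfolding cE using mono[of "Suc (g e)" c] c sS[of "g e"] by simp
    then have "d < card E" using hn[OF c(1)] d by simp
    \<comment> \<open>Both \<open>l e\<close> and \<open>d\<close> are below \<open>card E\<close>,
      so the step wraps around at most once.\<close>
    then consider "l e + d = l e'" | "l e + d = l e' + card E"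
      using cong lm by (auto simp: cong_def mod_less_double split: if_splits)
    then show False
    proof cases
      case 1
      have lt_g: "g e < g e'"
      proof (rule ccontr)
        assume "\<not> ?thesis"
        then have "s (Suc (g e')) \<le> s (g e)" using gne by (intro mono) simp
        with lt[OF e(2)] 1 show False by (simp add: l_def)
      qed
      show False
      proof (cases "g e' = Suc (g e)")
        case True
        then have "g e = cyc_pred c (g e')" by (simp add: cyc_pred_def)
        from cross[OF e adj this] p(1)[OF e(1)] 1 True d show False
          by (simp add: l_def sS)
      next
        case False
        \<comment> \<open>The whole class \<open>Suc (g e)\<close> lies between the two
          edges.\<close>
        then have "s (Suc (Suc (g e))) \<le> s (g e')" "Suc (g e) < c" using lt_g c by (auto intro: mono)
        with lt[OF e(1)] hn[of "Suc (g e)"] sS[of "Suc (g e)"] 1 d show False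
          by (simp add: l_def)
      qed
    next
      case 2
      \<comment> \<open>A step across the origin must leave from the last class and end in class
        \<open>0\<close>, since otherwise a full class would lie in between.\<close>
      have last: "Suc (g e) = c"
      proof (rule ccontr)
        assume "\<not> ?thesis"
        then have "s (Suc (Suc (g e))) \<le> s c" "Suc (g e) < c" using c by (auto intro: mono)
        with lt[OF e(1)] hn[of "Suc (g e)"] sS[of "Suc (g e)"] 2 d cE show False by simp
      qed
      have first: "g e' = 0"
      proof (rule ccontr)
        assume "\<not> ?thesis"
        then have "s (Suc 0) \<le> s (g e')" by (intro mono) simp
        with hn[of 0] sS[of 0] s0 c 2 d lm show False by (simp add: l_def)
      qed
      have "g e = cyc_pred c (g e')" using last first by (simp add: cyc_pred_def)
      from cross[OF e adj this] p(1)[OF e(1)] 2 d first show False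
        by (simp add: l_def cE last[symmetric] sS s0)
    qed
  qed
  with l that show ?thesis by blast
qed

section \<open>From an optimal edge colouring to the lower bound\<close>

text \<open>An injective colouring shows that the \<open>LEAST\<close> is attained. An optimal
  colouring may use arbitrary naturals, so its colours are renamed to an initial segment, as the
  block layout requires.\<close>

lemma chromatic_index_colouring:
  assumes fin: "finite E"
  obtains f where "proper_edge_colouring E f" "f ` E \<subseteq> {..<chromatic_index E}"
proof -
  obtain f0 :: "'a set \<Rightarrow> nat" where "inj_on f0 E" using finite_imp_inj_to_nat_seg[OF fin] by auto
  then have "proper_edge_colouring E f0"
    by (auto simp: proper_edge_colouring_def adjacent_def inj_on_def)
  then have "\<exists>f. proper_edge_colouring E f \<and> card (f ` E) = chromatic_index E"
    unfolding chromatic_index_def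
    by (intro LeastI_ex[of "\<lambda>k. \<exists>f. proper_edge_colouring E f \<and> card (f ` E) = k"]) blast
  then obtain f where f: "proper_edge_colouring E f" "card (f ` E) = chromatic_index E" by blast
  obtain b where b: "bij_betw b (f ` E) {..<chromatic_index E}"
    using ex_bij_betw_finite_nat[of "f ` E"] fin f(2) by (auto simp: atLeast0LessThan)
  have "proper_edge_colouring E (b \<circ> f)"
    using f(1) b by (auto simp: proper_edge_colouring_def bij_betw_def inj_on_def)
  moreover have "(b \<circ> f) ` E \<subseteq> {..<chromatic_index E}" using b by (auto simp: bij_betw_def)
  ultimately show ?thesis by (rule that)
qed

lemma cms_lower_bound:
  assumes fin: "finite E" and ne: "E \<noteq> {}" and c2: "\<And>e. e \<in> E \<Longrightarrow> card e = 2"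
  shows "\<lfloor>1 / (2 * real (chromatic_index E)) * real (card E)\<rfloor> - 1 \<le> int (cms E)"
proof -
  let ?c = "chromatic_index E"
  define h where "h = card E div (2 * ?c)"
  obtain f where f: "proper_edge_colouring E f" "f ` E \<subseteq> {..<?c}"
    using chromatic_index_colouring[OF fin] by blast
  have "(2 * h) * ?c \<le> card E"
    unfolding h_def by (metis div_times_less_eq_dividend mult.assoc mult.commute)
  from balanced_colouring[OF fin c2 this f] obtain g where
    g: "proper_edge_colouring E g" "g ` E \<subseteq> {..<?c}" "\<And>i. i < ?c \<Longrightarrow> 2 * h \<le> card {e \<in> E. g e = i}"
    by blast
  obtain l where l: "edge_ordering E l"
    and dist: "\<And>e e'. e \<in> E \<Longrightarrow> e' \<in> E \<Longrightarrow> adjacent e e' \<Longrightarrow> h \<le> cyc_dist E l e e' + 1"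
    using ordering_from_colouring[OF fin c2 g] by blast
  have "h - 1 \<le> cms E"
  \<comment> \<open>\<open>cms_geI\<close> needs a positive candidate; for \<open>h < 2\<close> the
    truncated difference \<open>h - 1\<close> is zero.\<close>
  proof (cases "2 \<le> h")
    case True
    have "h \<le> card E" by (simp add: h_def)
    with True show ?thesis
      using dist by (intro cms_geI[OF l fin ne]) fastforce+
  next
    case False
    then show ?thesis by simp
  qed
  moreover have "\<lfloor>1 / (2 * real ?c) * real (card E)\<rfloor> = int h"
    using floor_divide_of_nat_eq[of "card E" "2 * ?c"] by (simp add: h_def)
  ultimately show ?thesis by linarith
qed

theorem theorem1p3:
  "(\<forall>(V :: 'a set) E. simple_graph V E \<and> E \<noteq> {} \<longrightarrow>
      \<lfloor>1 / (2 * real (chromatic_index E)) * real (card E)\<rfloor> - 1 \<le> int (cms E) \<and>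
      real (cms E) \<le> 1 / fractional_chromatic_index E * real (card E)) \<and>
   (\<forall>\<Delta> n :: nat. 2 \<le> \<Delta> \<and> \<Delta> + 1 \<le> n \<longrightarrow>
      (\<exists>(V :: nat set) E. simple_graph V E \<and> E \<noteq> {} \<and> card V = n \<and>
         real (cms E) \<le> 1 / (real \<Delta> + 1) * real (card E)))"
proof (intro conjI allI impI)
  fix V :: "'a set" and E assume "simple_graph V E \<and> E \<noteq> {}"
  then have E: "E \<noteq> {}" "\<And>e. e \<in> E \<Longrightarrow> card e = 2" and "E \<subseteq> Pow V" "finite V"
    by (auto simp: simple_graph_def)
  then have fin: "finite E" by (metis finite_Pow_iff finite_subset)
  show "\<lfloor>1 / (2 * real (chromatic_index E)) * real (card E)\<rfloor> - 1 \<le> int (cms E)"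
    using fin E by (rule cms_lower_bound)
  show "real (cms E) \<le> 1 / fractional_chromatic_index E * real (card E)"
    using fin E(1) by (rule cms_upper_bound)
next
  fix \<Delta> n :: nat assume "2 \<le> \<Delta> \<and> \<Delta> + 1 \<le> n"
  then have n: "3 \<le> n" "real \<Delta> + 1 \<le> real n" by auto
  \<comment> \<open>With \<open>cms\<close> equal to 1 and exactly \<open>n\<close> edges, the bound
    reads \<open>\<Delta> + 1 \<le> n\<close>.\<close>
  have "real (cms (star_plus n)) \<le> 1 / (real \<Delta> + 1) * real (card (star_plus n))"
    using n(2) unfolding cms_star_plus[OF n(1)] card_star_plus[OF n(1)] by (simp add: field_simps)
  moreover have "star_plus n \<noteq> {}" "card {..<n} = n" by (simp_all add: star_plus_def)
  ultimately show "\<exists>(V :: nat set) E. simple_graph V E \<and> E \<noteq> {} \<and> card V = n \<and>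
         real (cms E) \<le> 1 / (real \<Delta> + 1) * real (card E)"
    using simple_graph_star_plus[OF n(1)] by blast
qed

end
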